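(* For integers $m\ge 5$ and $b$ with $3\le b\le \frac{5m-16}{3}$ and $b\equiv m\pmod 2$, let $$f(5,m,b)(q)=\binom{m}{5}_q-q^{\frac{5m-3b-16}{2}}\binom{b}{3}_q .$$ Then for all sufficiently large $m$, the polynomial $f(5,m,b)$ is nonnegative and unimodal for every such $b$, with the only exception of $b=\frac{5m-18}{3}$ when this is an integer (i.e., when $3$ divides $2m-6$), in which case $f(5,m,b)$ is not both nonnegative and unimodal.
   Context: For integers $m\ge k\ge 0$ the $q$-binomial coefficient is $\binom{m}{k}_q=\prod_{i=1}^{m}(1-q^i)\big/\big(\prod_{i=1}^{k}(1-q^i)\prod_{i=1}^{m-k}(1-q^i)\big)$. A polynomial is nonnegative if all its coefficients are $\ge 0$, and unimodal if its coefficient sequence weakly increases up to some index and weakly decreases afterwards. *)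

theory Defs
  imports
    "HOL-Computational_Algebra.Polynomial"
    "HOL-Number_Theory.Cong"
begin

definition q_poch :: "nat \<Rightarrow> int poly" where
  "q_poch n = (\<Prod>i = 1..n. 1 - monom 1 i)"

text \<open>
  The division on \<^typ>\<open>int poly\<close> below is exact for \<open>k \<le> m\<close>; see \<open>q_binomial_mult\<close>.
  Only that range is meaningful.
\<close>

definition q_binomial :: "nat \<Rightarrow> nat \<Rightarrow> int poly" where
  "q_binomial m k = q_poch m div (q_poch k * q_poch (m - k))"

definition nonneg_poly :: "int poly \<Rightarrow> bool" where
  "nonneg_poly p \<longleftrightarrow> (\<forall>i. coeff p i \<ge> 0)"

text \<open>
  The coefficient sequence of \<open>p\<close> is the finite sequence indexed by \<open>0, \<dots>, degree p\<close>.
\<close>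

definition unimodal_poly :: "int poly \<Rightarrow> bool" where
  "unimodal_poly p \<longleftrightarrow>
     (\<exists>k \<le> degree p. mono_on {0..k} (coeff p) \<and> antimono_on {k..degree p} (coeff p))"

text \<open>
  The exponent is an exact half of a natural number whenever \<open>3 * b + 16 \<le> 5 * m\<close> and \<open>b\<close>, \<open>m\<close>
  have the same parity; truncation and rounding play no role then.
\<close>

definition f5 :: "nat \<Rightarrow> nat \<Rightarrow> int poly" where
  "f5 m b = q_binomial m 5 - monom 1 ((5 * m - 3 * b - 16) div 2) * q_binomial b 3"

lemma q_poch_0 [simp]: "q_poch 0 = 1"
  by (simp add: q_poch_def)

lemma q_poch_Suc: "q_poch (Suc n) = q_poch n * (1 - monom 1 (Suc n))"
  by (simp add: q_poch_def)

lemma q_poch_nonzero: "q_poch n \<noteq> 0"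
proof (induction n)
  case (Suc n)
  have "coeff (1 - monom 1 (Suc n) :: int poly) 0 = 1"
    by simp
  then have "(1 - monom 1 (Suc n) :: int poly) \<noteq> 0"
    by (metis coeff_0 zero_neq_one)
  with Suc show ?case
    by (simp add: q_poch_Suc)
qed simp

lemma q_poch_dvd: "q_poch k * q_poch l dvd q_poch (k + l)"
proof (induction "k + l" arbitrary: k l)
  case 0
  then show ?case by simp
next
  case (Suc n)
  show ?case
  proof (cases "k = 0 \<or> l = 0")
    case True
    then show ?thesis by auto
  next
    case False
    then obtain k' l' where k: "k = Suc k'" and l: "l = Suc l'"
      by (meson not0_implies_Suc)
    have 1: "q_poch k' * q_poch l dvd q_poch n" and 2: "q_poch k * q_poch l' dvd q_poch n"
      using Suc.hyps(1)[of k' l] Suc.hyps(1)[of k l'] Suc.hyps(2) k l by auto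
    have split: "(1 - monom 1 (Suc n) :: int poly) =
        (1 - monom 1 k) + monom 1 k * (1 - monom 1 l)"
      using Suc.hyps(2) by (simp add: algebra_simps mult_monom)
    have "q_poch k * q_poch l dvd q_poch n * (1 - monom 1 k)"
      using mult_dvd_mono[OF 1 dvd_refl[of "1 - monom 1 k"]]
      by (simp add: k q_poch_Suc mult_ac)
    moreover have "q_poch k * q_poch l dvd q_poch n * (1 - monom 1 l)"
      using mult_dvd_mono[OF 2 dvd_refl[of "1 - monom 1 l"]]
      by (simp add: l q_poch_Suc mult_ac)
    ultimately have "q_poch k * q_poch l dvd
        q_poch n * (1 - monom 1 k) + monom 1 k * (q_poch n * (1 - monom 1 l))"
      by (metis dvd_add dvd_mult)
    also have "\<dots> = q_poch (Suc n)"
      unfolding q_poch_Suc split by (simp only: distrib_left mult_ac)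
    finally show ?thesis
      using Suc.hyps(2) by simp
  qed
qed

lemma q_binomial_mult:
  assumes "k \<le> m"
  shows "q_binomial m k * (q_poch k * q_poch (m - k)) = q_poch m"
  using q_poch_dvd[of k "m - k"] assms by (simp add: q_binomial_def)

end

theory Submission
  imports Defs "HOL-Computational_Algebra.Polynomial_FPS"
begin

text \<open>
  Put \<open>n = m - 5\<close>, \<open>c = b - 3\<close> and let \<open>j = (5 n - 3 c) / 2\<close> be the shift. Both Gaussian binomials are
  palindromic and after the shift they have the common centre \<open>5 n / 2\<close>. So \<open>f5 m b\<close> is palindromic,
  and it suffices that its increments are nonnegative up to the centre.

  The increments of the Gaussian binomials are the coefficients of their products with \<open>1 - q\<close>, that is,
  signed sums of shifts of \<open>P\<close>, the number of partitions into parts \<open>2, 3, 4, 5\<close>, respectively of \<open>Q\<close>,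
  the number of partitions into parts \<open>2, 3\<close>. The increment of the subtracted polynomial at \<open>x\<close> is
  at most \<open>Q (x - j)\<close>, and \<open>Q (x - j) \<le> Q x\<close> unless \<open>j = 1\<close>, because every other \<open>j\<close> is a sum of twos and
  threes. For \<open>x \<le> n\<close> the increment of the first polynomial is \<open>P x \<ge> Q x\<close>. For \<open>n < x \<le> 5 n / 2\<close>
  the estimate \<open>720 P x = x\<^sup>3 + 21 x\<^sup>2 + O(x)\<close> bounds it below by \<open>n\<^sup>2 / 720 - O(n)\<close>, which eventually
  exceeds \<open>Q (x - j) = O(n)\<close>. If \<open>j = 1\<close>, the coefficients begin \<open>1, 0, 1\<close>.
\<close>

section \<open>Coefficients indexed by integers\<close>

text \<open>Extending coefficient sequences by zero to negative indices makes multiplication by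
  \<open>1 - fps_X ^ k\<close> an unconditional difference.\<close>

definition zcoeff :: "int fps \<Rightarrow> int \<Rightarrow> int" where
  "zcoeff F x = (if x < 0 then 0 else fps_nth F (nat x))"

lemma zcoeff_neg [simp]: "x < 0 \<Longrightarrow> zcoeff F x = 0"
  by (simp add: zcoeff_def)

lemma zcoeff_of_nat: "zcoeff F (int i) = fps_nth F i"
  by (simp add: zcoeff_def)

lemma zcoeff_diff: "zcoeff (F - G) x = zcoeff F x - zcoeff G x"
  by (simp add: zcoeff_def)

lemma zcoeff_X_power_mult: "zcoeff (fps_X ^ k * F) x = zcoeff F (x - int k)"
  by (auto simp: zcoeff_def fps_X_power_mult_nth nat_diff_distrib' nat_less_iff
      intro!: arg_cong[where f = "\<lambda>i. fps_nth F i"])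

lemma zcoeff_one_minus_X_power_mult:
  "zcoeff ((1 - fps_X ^ k) * F) x = zcoeff F x - zcoeff F (x - int k)"
  by (simp add: left_diff_distrib zcoeff_diff zcoeff_X_power_mult)

text \<open>The power series of 1 / (1 - q^k) when \<open>k > 0\<close>, given by its coefficients
  so that nonnegativity is immediate.\<close>

definition geom_fps :: "nat \<Rightarrow> int fps" where
  "geom_fps k = Abs_fps (\<lambda>i. if k dvd i then 1 else 0)"

lemma geom_fps_inverse:
  assumes "k > 0"
  shows "(1 - fps_X ^ k) * geom_fps k = 1"
proof (rule fps_ext)
  fix i
  show "fps_nth ((1 - fps_X ^ k) * geom_fps k) i = fps_nth 1 i"
    using assms
    by (cases "i < k")
      (auto simp: left_diff_distrib fps_X_power_mult_nth geom_fps_def dvd_minus_self dest: dvd_imp_le)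
qed

section \<open>Partitions into parts from 2 to 5\<close>

text \<open>\<open>part23\<close> generates the counts \<open>Q\<close> and \<open>part2345\<close>
  the counts \<open>P\<close>. Adjoining one part size at a time yields the recurrences.\<close>

definition part23 :: "int fps" where "part23 = geom_fps 2 * geom_fps 3"

definition part234 :: "int fps" where "part234 = geom_fps 4 * part23"

definition part2345 :: "int fps" where "part2345 = geom_fps 5 * part234"

lemma fps_mult_nth_nonneg:
  assumes "\<And>i. fps_nth F i \<ge> 0" "\<And>i. fps_nth G i \<ge> 0"
  shows "fps_nth (F * G) i \<ge> (0::int)"
  using assms by (auto simp: fps_mult_nth intro!: sum_nonneg)

lemma geom_fps_nonneg: "fps_nth (geom_fps k) i \<ge> 0"
  by (simp add: geom_fps_def)

lemma part_fps_nonneg: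
  "zcoeff part23 x \<ge> 0" "zcoeff part234 x \<ge> 0" "zcoeff part2345 x \<ge> 0"
  by (simp_all add: zcoeff_def part23_def part234_def part2345_def fps_mult_nth_nonneg geom_fps_nonneg)

lemma zcoeff_geom_fps: "zcoeff (geom_fps k) x = (if 0 \<le> x \<and> int k dvd x then 1 else 0)"
  by (cases x) (simp_all add: zcoeff_def geom_fps_def)

lemma zcoeff_geom_mult:
  assumes "k > 0"
  shows "zcoeff (geom_fps k * F) x = zcoeff (geom_fps k * F) (x - int k) + zcoeff F x"
proof -
  have *: "(1 - fps_X ^ k) * (geom_fps k * F) = F"
    by (simp only: mult.assoc[symmetric] geom_fps_inverse[OF assms] mult_1)
  show ?thesis
    using zcoeff_one_minus_X_power_mult[of k "geom_fps k * F" x] unfolding * by linarith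
qed

section \<open>Recurrences for the counts, and growth for parts 2 and 3\<close>

lemma part23_rec2: "zcoeff part23 x = zcoeff part23 (x - 2) + zcoeff (geom_fps 3) x"
  using zcoeff_geom_mult[of 2 "geom_fps 3" x] by (simp add: part23_def)

lemma part23_rec3: "zcoeff part23 x = zcoeff part23 (x - 3) + zcoeff (geom_fps 2) x"
  using zcoeff_geom_mult[of 3 "geom_fps 2" x] by (simp add: part23_def mult.commute)

lemma part234_rec: "zcoeff part234 x = zcoeff part234 (x - 4) + zcoeff part23 x"
  using zcoeff_geom_mult[of 4 part23 x] by (simp add: part234_def)

lemma part2345_rec: "zcoeff part2345 x = zcoeff part2345 (x - 5) + zcoeff part234 x"
  using zcoeff_geom_mult[of 5 part234 x] by (simp add: part2345_def)

lemma part23_le_part2345: "zcoeff part23 x \<le> zcoeff part2345 x"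
  using part234_rec[of x] part2345_rec[of x] part_fps_nonneg[of "x - 4"] part_fps_nonneg[of "x - 5"]
  by linarith

text \<open>A shift by 2 or 3 changes the count by a coefficient of a geometric series, which is
  nonnegative. Peeling off twos while \<open>j \<ge> 4\<close> leaves 2 or 3, never 1.\<close>

lemma part23_shift_le:
  "j \<noteq> 1 \<Longrightarrow> zcoeff part23 (x - int j) \<le> zcoeff part23 x"
proof (induction j arbitrary: x rule: less_induct)
  case (less j)
  have 2: "zcoeff part23 (x - 2) \<le> zcoeff part23 x"
    and 3: "zcoeff part23 (x - 3) \<le> zcoeff part23 x" for x
    using part23_rec2[of x] part23_rec3[of x] by (auto simp: zcoeff_geom_fps split: if_splits)
  consider "j = 0" | "j = 2" | "j = 3" | "j \<ge> 4"
    using less.prems by linarith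
  then show ?case
  proof cases
    case 4
    then have "zcoeff part23 (x - 2 - int (j - 2)) \<le> zcoeff part23 (x - 2)"
      by (intro less.IH) auto
    then show ?thesis using 4 2[of x] by (simp add: of_nat_diff)
  qed (use 2 3 in auto)
qed

text \<open>Two steps of 3 contribute one unit in all, since exactly one of \<open>x + 3\<close> and
  \<open>x + 6\<close> is even.\<close>

lemma part23_add_6:
  assumes "x \<ge> 0"
  shows "zcoeff part23 (x + 6) = zcoeff part23 x + 1"
  using part23_rec3[of "x + 6"] part23_rec3[of "x + 3"] assms
  by (simp add: zcoeff_geom_fps add.commute)

lemma part_fps_at_0: "zcoeff part23 0 = 1" "zcoeff part234 0 = 1"
  using part23_rec3[of 0] part234_rec[of 0] by (auto simp: zcoeff_geom_fps)

lemma part23_small: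
  "zcoeff part23 1 = 0" "zcoeff part23 2 = 1" "zcoeff part23 3 = 1" "zcoeff part23 4 = 1"
  "zcoeff part23 5 = 1"
  using part23_rec3[of 1] part23_rec3[of 2] part23_rec3[of 3] part23_rec3[of 4] part23_rec3[of 5]
    part_fps_at_0
  by (auto simp: zcoeff_geom_fps)

lemma int_step_induct:
  fixes x d :: int
  assumes "d > 0" "x \<ge> 0"
    and base: "\<And>x. 0 \<le> x \<Longrightarrow> x < d \<Longrightarrow> P x"
    and step: "\<And>x. 0 \<le> x \<Longrightarrow> P x \<Longrightarrow> P (x + d)"
  shows "P x"
  using \<open>x \<ge> 0\<close>
proof (induction "nat x" arbitrary: x rule: less_induct)
  case less
  show ?case
  proof (cases "x < d")
    case False
    then have "P (x - d)"
      using less \<open>d > 0\<close> by (intro less.hyps) auto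
    then show ?thesis
      using step[of "x - d"] False by simp
  qed (use base less.prems in blast)
qed

lemma part23_le:
  assumes "x \<ge> 0"
  shows "6 * zcoeff part23 x \<le> x + 6"
proof (rule int_step_induct[of 6 x])
  fix x :: int assume "0 \<le> x" "x < 6"
  then consider "x = 0" | "x = 1" | "x = 2" | "x = 3" | "x = 4" | "x = 5" by linarith
  then show "6 * zcoeff part23 x \<le> x + 6"
    by cases (auto simp: part23_small part_fps_at_0)
qed (use assms part23_add_6 in auto)

text \<open>Moving \<open>x\<close> to \<open>x + 2\<close> exchanges the term at \<open>x\<close>
  for the one at \<open>x + 6\<close>, which adds 1.\<close>

lemma part23_sum:
  assumes "x \<ge> 0"
  shows "zcoeff part23 x + zcoeff part23 (x + 2) + zcoeff part23 (x + 4) =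
    (if even x then 3 else 2) + x div 2"
proof (rule int_step_induct[of 2 x])
  fix x :: int assume "0 \<le> x" "x < 2"
  then consider "x = 0" | "x = 1" by linarith
  then show "zcoeff part23 x + zcoeff part23 (x + 2) + zcoeff part23 (x + 4) =
    (if even x then 3 else 2) + x div 2"
    by cases (auto simp: part23_small part_fps_at_0)
next
  fix x :: int
  assume "0 \<le> x" "zcoeff part23 x + zcoeff part23 (x + 2) + zcoeff part23 (x + 4) =
    (if even x then 3 else 2) + x div 2"
  then show "zcoeff part23 (x + 2) + zcoeff part23 (x + 2 + 2) + zcoeff part23 (x + 2 + 4) =
    (if even (x + 2) then 3 else 2) + (x + 2) div 2"
    using part23_add_6[of x] by (simp add: algebra_simps)
qed (use assms in auto)

section \<open>Increments over a period and the cubic approximation\<close>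

lemma part234_add_12:
  assumes "x \<ge> 0"
  shows "4 * zcoeff part234 (x + 12) = 4 * zcoeff part234 x + 2 * x + (if even x then 24 else 18)"
proof -
  have "zcoeff part234 (x + 12) =
      zcoeff part234 x + (zcoeff part23 (x + 4) + zcoeff part23 (x + 8) + zcoeff part23 (x + 12))"
    using part234_rec[of "x + 12"] part234_rec[of "x + 8"] part234_rec[of "x + 4"]
    by (simp add: add.commute)
  \<comment> \<open>Modulo 6 the offsets 4, 8, 12 become 4, 2, 0, the triple of
    \<open>part23_sum\<close>.\<close>
  moreover have "zcoeff part23 (x + 8) = zcoeff part23 (x + 2) + 1"
    "zcoeff part23 (x + 12) = zcoeff part23 x + 2"
    using part23_add_6[of x] part23_add_6[of "x + 6"] part23_add_6[of "x + 2"] assms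
    by (simp_all add: add.commute)
  moreover have "4 * (x div 2) = 2 * x - (if even x then 0 else 2)"
    by presburger
  ultimately show ?thesis
    using part23_sum[OF assms] by (smt (verit))
qed

text \<open>The increments over 12 are linear in the argument; the last summand is the arithmetic
  series that they produce.\<close>

lemma part234_add_mult_12:
  assumes "x \<ge> 0"
  shows "4 * zcoeff part234 (x + 12 * int k) =
    4 * zcoeff part234 x + int k * (2 * x + (if even x then 24 else 18)) + 12 * int k * (int k - 1)"
proof (induction k)
  case (Suc k)
  show ?case
    using part234_add_12[of "x + 12 * int k"] assms Suc.IH by (simp add: algebra_simps)
qed simp

lemma sum_window_shift:
  fixes g :: "int \<Rightarrow> int"
  shows "(\<Sum>r<k. g (x + 1 + int r)) = (\<Sum>r<k. g (x + int r)) + g (x + int k) - g x"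
proof -
  have "(\<Sum>r<Suc k. g (x + int r)) = g x + (\<Sum>r<k. g (x + 1 + int r))"
    by (subst sum.lessThan_Suc_shift) (simp add: algebra_simps)
  then show ?thesis by simp
qed

lemma lessThan_12: "{..<12::nat} = {0,1,2,3,4,5,6,7,8,9,10,11}"
  by (auto simp: lessThan_nat_numeral lessThan_Suc)

text \<open>Sliding the window by one changes the sum by an increment over 12, known from
  \<open>part234_add_12\<close>; only the window at 0 is computed.\<close>

lemma part234_sum:
  assumes "x \<ge> 0"
  shows "4 * (\<Sum>r<12. zcoeff part234 (x + int r)) =
    x\<^sup>2 + 20 * x + (if even x then 108 else 111)"
proof (rule int_step_induct[of 1 x])
  fix x :: int assume "0 \<le> x" "x < 1"
  then have x: "x = 0" by simp
  have q: "zcoeff part23 6 = 2" "zcoeff part23 7 = 1" "zcoeff part23 8 = 2" "zcoeff part23 9 = 2"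
    "zcoeff part23 10 = 2" "zcoeff part23 11 = 2"
    using part23_add_6[of 0] part23_add_6[of 1] part23_add_6[of 2] part23_add_6[of 3]
      part23_add_6[of 4] part23_add_6[of 5] by (simp_all add: part23_small part_fps_at_0)
  have "zcoeff part234 1 = 0" "zcoeff part234 2 = 1" "zcoeff part234 3 = 1" "zcoeff part234 4 = 2"
    "zcoeff part234 5 = 1" "zcoeff part234 6 = 3" "zcoeff part234 7 = 2" "zcoeff part234 8 = 4"
    "zcoeff part234 9 = 3" "zcoeff part234 10 = 5" "zcoeff part234 11 = 4"
    using part234_rec[of 1] part234_rec[of 2] part234_rec[of 3] part234_rec[of 4] part234_rec[of 5]
      part234_rec[of 6] part234_rec[of 7] part234_rec[of 8] part234_rec[of 9] part234_rec[of 10]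
      part234_rec[of 11] by (simp_all add: part23_small part_fps_at_0 q)
  then show "4 * (\<Sum>r<12. zcoeff part234 (x + int r)) =
      x\<^sup>2 + 20 * x + (if even x then 108 else 111)"
    by (simp add: x part_fps_at_0 lessThan_12)
next
  fix x :: int
  assume "0 \<le> x" "4 * (\<Sum>r<12. zcoeff part234 (x + int r)) =
      x\<^sup>2 + 20 * x + (if even x then 108 else 111)"
  then show "4 * (\<Sum>r<12. zcoeff part234 (x + 1 + int r)) =
      (x + 1)\<^sup>2 + 20 * (x + 1) + (if even (x + 1) then 108 else 111)"
    using part234_add_12[of x] sum_window_shift[of "zcoeff part234" x 12]
    by (cases "even x") (simp_all add: power2_eq_square algebra_simps)
qed (use assms in auto)

text \<open>Going up by 60 takes twelve steps of 5. As 5 and 12 are coprime, the offsets meet each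
  class modulo 12 once, and reducing them yields the window of \<open>part234_sum\<close>.\<close>

lemma part2345_add_60:
  assumes "x \<ge> 0"
  shows "4 * (zcoeff part2345 (x + 60) - zcoeff part2345 x) =
    x\<^sup>2 + 74 * x + (if even x then 1672 else 1657)"
proof -
  let ?R = "\<lambda>j. zcoeff part234 (x + j)"
  have "zcoeff part2345 (x + 60) - zcoeff part2345 x =
      ?R 5 + ?R 10 + ?R 15 + ?R 20 + ?R 25 + ?R 30 + ?R 35 + ?R 40 + ?R 45 + ?R 50 + ?R 55 + ?R 60"
    using part2345_rec[of "x + 5"] part2345_rec[of "x + 10"] part2345_rec[of "x + 15"]
      part2345_rec[of "x + 20"] part2345_rec[of "x + 25"] part2345_rec[of "x + 30"]
      part2345_rec[of "x + 35"] part2345_rec[of "x + 40"] part2345_rec[of "x + 45"]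
      part2345_rec[of "x + 50"] part2345_rec[of "x + 55"] part2345_rec[of "x + 60"]
    by (simp add: add.commute)
  \<comment> \<open>Offsets 5 and 10 are already reduced. An odd reduced offset flips the parity,
    hence the swapped 18 and 24; the constants 24, 72, 144, 240 are
    \<open>12 * k * (k - 1)\<close>.\<close>
  moreover have
    "4 * ?R 15 = 4 * ?R 3 + (2 * (x + 3) + (if even x then 18 else 24))"
    "4 * ?R 20 = 4 * ?R 8 + (2 * (x + 8) + (if even x then 24 else 18))"
    "4 * ?R 25 = 4 * ?R 1 + 2 * (2 * (x + 1) + (if even x then 18 else 24)) + 24"
    "4 * ?R 30 = 4 * ?R 6 + 2 * (2 * (x + 6) + (if even x then 24 else 18)) + 24"
    "4 * ?R 35 = 4 * ?R 11 + 2 * (2 * (x + 11) + (if even x then 18 else 24)) + 24"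
    "4 * ?R 40 = 4 * ?R 4 + 3 * (2 * (x + 4) + (if even x then 24 else 18)) + 72"
    "4 * ?R 45 = 4 * ?R 9 + 3 * (2 * (x + 9) + (if even x then 18 else 24)) + 72"
    "4 * ?R 50 = 4 * ?R 2 + 4 * (2 * (x + 2) + (if even x then 24 else 18)) + 144"
    "4 * ?R 55 = 4 * ?R 7 + 4 * (2 * (x + 7) + (if even x then 18 else 24)) + 144"
    "4 * ?R 60 = 4 * ?R 0 + 5 * (2 * x + (if even x then 24 else 18)) + 240"
    using part234_add_mult_12[of "x + 3" 1] part234_add_mult_12[of "x + 8" 1]
      part234_add_mult_12[of "x + 1" 2] part234_add_mult_12[of "x + 6" 2]
      part234_add_mult_12[of "x + 11" 2] part234_add_mult_12[of "x + 4" 3]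
      part234_add_mult_12[of "x + 9" 3] part234_add_mult_12[of "x + 2" 4]
      part234_add_mult_12[of "x + 7" 4] part234_add_mult_12[of x 5] assms
    by (simp_all add: add.assoc)
  moreover have "(\<Sum>r<12. zcoeff part234 (x + int r)) =
      ?R 0 + ?R 1 + ?R 2 + ?R 3 + ?R 4 + ?R 5 + ?R 6 + ?R 7 + ?R 8 + ?R 9 + ?R 10 + ?R 11"
    by (simp add: lessThan_12)
  ultimately show ?thesis
    using part234_sum[OF assms] by (cases "even x") simp_all
qed

text \<open>The two leading terms of \<open>720 * zcoeff part2345 x\<close>. The quadratic one matters: at the centre of
  \<open>q_binomial (n + 5) 5\<close> the cubic contributions cancel.\<close>

definition cub :: "int \<Rightarrow> int" where
  "cub x = x ^ 3 + 21 * x\<^sup>2"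

text \<open>\<open>cub\<close> matches the increments over 60 up to bounded terms, so the error
  grows at most linearly. Some negative arguments, where the count is 0, are included because
  shifted terms reach slightly below 0.\<close>

lemma part2345_estimate:
  obtains K :: int where "K \<ge> 0"
    "\<And>x. x \<ge> -14 \<Longrightarrow> \<bar>720 * zcoeff part2345 x - cub x\<bar> \<le> K * (\<bar>x\<bar> + 1)"
proof -
  define E where "E x = 720 * zcoeff part2345 x - cub x" for x
  \<comment> \<open>The maximum covers the initial window; 10000 exceeds the error increments 9360
    and 6660.\<close>
  define K where "K = Max ((\<lambda>x. \<bar>E x\<bar>) ` {-14..<60}) + 10000"
  have small: "\<bar>E x\<bar> \<le> K - 10000" if "-14 \<le> x" "x < 60" for x
    unfolding K_def using that by (auto intro!: Max_ge)
  have K: "K \<ge> 10000"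
    using small[of 0] by linarith
  have bound: "\<bar>E x\<bar> \<le> K * (x + 1)" if "x \<ge> 0" for x
  proof (rule int_step_induct[of 60 x])
    fix x :: int assume x: "0 \<le> x" "x < 60"
    then have "K * 1 \<le> K * (x + 1)"
      using K by (intro mult_left_mono) auto
    then show "\<bar>E x\<bar> \<le> K * (x + 1)"
      using small[of x] x by linarith
  next
    fix x :: int assume x: "0 \<le> x" "\<bar>E x\<bar> \<le> K * (x + 1)"
    have "E (x + 60) - E x = (if even x then 9360 else 6660)"
      using part2345_add_60[OF x(1)]
      by (auto simp: E_def cub_def power2_eq_square power3_eq_cube algebra_simps split: if_splits)
    then have "\<bar>E (x + 60)\<bar> \<le> \<bar>E x\<bar> + 10000"
      by (auto split: if_splits)
    then show "\<bar>E (x + 60)\<bar> \<le> K * (x + 60 + 1)"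
      using x K by (simp add: algebra_simps)
  qed (use that in auto)
  have "\<bar>E x\<bar> \<le> K * (\<bar>x\<bar> + 1)" if "x \<ge> -14" for x
  proof (cases "x \<ge> 0")
    case False
    then have "K * 1 \<le> K * (\<bar>x\<bar> + 1)"
      using K by (intro mult_left_mono) auto
    then show ?thesis using small[of x] that False by linarith
  qed (use bound in auto)
  then show thesis
    using that[of K] K by (auto simp: E_def)
qed

section \<open>Gaussian binomial coefficients\<close>

lemma q_poch_add: "q_poch (n + k) = q_poch n * (\<Prod>i = 1..k. 1 - monom 1 (n + i))"
  by (induction k) (simp_all add: q_poch_Suc mult.assoc)

text \<open>Cancelling \<open>q_poch n\<close> turns the exact division into a product
  identity.\<close>

lemma q_binomial_mult_q_poch:
  "q_binomial (n + k) k * q_poch k = (\<Prod>i = 1..k. 1 - monom 1 (n + i))"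
proof -
  have "q_poch n * (q_binomial (n + k) k * q_poch k) = q_poch n * (\<Prod>i = 1..k. 1 - monom 1 (n + i))"
    using q_binomial_mult[of k "n + k"] by (simp add: q_poch_add mult_ac)
  then show ?thesis
    using q_poch_nonzero[of n] by simp
qed

lemma degree_one_minus_monom: "degree (1 - monom 1 (Suc n) :: int poly) = Suc n"
  using degree_add_eq_right[of 1 "- monom 1 (Suc n) :: int poly"] by (simp add: degree_monom_eq)

lemma reflect_one_minus_monom:
  "reflect_poly (1 - monom 1 (Suc n) :: int poly) = - (1 - monom 1 (Suc n))"
  by (rule poly_eqI) (auto simp: coeff_reflect_poly degree_one_minus_monom)

lemma degree_q_poch: "2 * degree (q_poch n) = n * (n + 1)"
proof (induction n)
  case (Suc n)
  have "q_poch (Suc n) \<noteq> 0" by (rule q_poch_nonzero)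
  then have "degree (q_poch (Suc n)) = degree (q_poch n) + Suc n"
    by (simp add: q_poch_Suc degree_mult_eq degree_one_minus_monom)
  with Suc show ?case by simp
qed simp

lemma reflect_q_poch: "reflect_poly (q_poch n) = (-1) ^ n * q_poch n"
proof (induction n)
  case (Suc n)
  show ?case
    unfolding q_poch_Suc reflect_poly_mult reflect_one_minus_monom Suc.IH
    by (simp add: algebra_simps)
qed simp

lemma degree_q_binomial: "degree (q_binomial (n + k) k) = k * n"
proof -
  have "degree (q_binomial (n + k) k) + (degree (q_poch k) + degree (q_poch n)) =
      degree (q_poch (n + k))"
    using q_binomial_mult[of k "n + k"]
    by (metis add_diff_cancel_right' degree_mult_eq le_add2 mult_eq_0_iff q_poch_nonzero)
  then show ?thesis
    using degree_q_poch[of k] degree_q_poch[of n] degree_q_poch[of "n + k"]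
    by (simp add: algebra_simps)
qed

text \<open>Reflection negates every factor 1 - q^i; numerator and denominator both have
  \<open>n + k\<close> of them, so the signs cancel.\<close>

lemma reflect_q_binomial: "reflect_poly (q_binomial (n + k) k) = q_binomial (n + k) k"
proof -
  define D where "D = q_poch k * q_poch n"
  have D: "q_binomial (n + k) k * D = q_poch (n + k)"
    using q_binomial_mult[of k "n + k"] by (simp add: D_def)
  have "reflect_poly (q_binomial (n + k) k) * ((-1) ^ (n + k) * D) = (-1) ^ (n + k) * q_poch (n + k)"
    using arg_cong[OF D, of reflect_poly]
    by (simp add: D_def reflect_poly_mult reflect_q_poch power_add mult_ac)
  also have "\<dots> = q_binomial (n + k) k * ((-1) ^ (n + k) * D)"
    by (simp add: D[symmetric] mult_ac)
  finally show ?thesis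
    by (simp add: D_def q_poch_nonzero)
qed

lemma coeff_q_binomial_sym:
  "i \<le> k * n \<Longrightarrow> coeff (q_binomial (n + k) k) (k * n - i) = coeff (q_binomial (n + k) k) i"
  using arg_cong[OF reflect_q_binomial, of "\<lambda>p. coeff p i" n k]
  by (simp add: coeff_reflect_poly degree_q_binomial)

section \<open>Increments as signed sums of partition counts\<close>

lemma fps_of_poly_one_minus_monom: "fps_of_poly (1 - monom 1 k :: int poly) = 1 - fps_X ^ k"
  by (simp add: fps_of_poly_diff fps_of_poly_monom')

lemma part23_inverse: "(1 - fps_X ^ 2) * (1 - fps_X ^ 3) * part23 = 1"
proof -
  have "(1 - fps_X ^ 2) * (1 - fps_X ^ 3) * part23 =
      ((1 - fps_X ^ 2) * geom_fps 2) * ((1 - fps_X ^ 3) * geom_fps 3)"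
    by (simp only: part23_def mult_ac)
  then show ?thesis by (simp only: geom_fps_inverse zero_less_numeral mult_1)
qed

lemma part2345_inverse:
  "(1 - fps_X ^ 2) * (1 - fps_X ^ 3) * (1 - fps_X ^ 4) * (1 - fps_X ^ 5) * part2345 = 1"
proof -
  have "(1 - fps_X ^ 2) * (1 - fps_X ^ 3) * (1 - fps_X ^ 4) * (1 - fps_X ^ 5) * part2345 =
      ((1 - fps_X ^ 2) * (1 - fps_X ^ 3) * part23) *
      (((1 - fps_X ^ 4) * geom_fps 4) * ((1 - fps_X ^ 5) * geom_fps 5))"
    by (simp only: part2345_def part234_def mult_ac)
  then show ?thesis by (simp only: part23_inverse geom_fps_inverse zero_less_numeral mult_1)
qed

text \<open>Multiplication by 1 - q absorbs the first factor of \<open>q_poch 3\<close>, leaving the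
  parts 2 and 3. Nesting the numerator to the right lets each factor unfold as a difference.\<close>

lemma fps_q_binomial_3:
  "(1 - fps_X) * fps_of_poly (q_binomial (c + 3) 3) =
   (1 - fps_X ^ (c + 1)) * ((1 - fps_X ^ (c + 2)) * ((1 - fps_X ^ (c + 3)) * part23))"
proof -
  have q: "q_poch 3 = (1 - monom 1 1) * (1 - monom 1 2) * (1 - monom 1 3)"
    and p: "(\<Prod>i = 1..3. 1 - monom 1 (c + i)) =
      (1 - monom 1 (c + 1)) * (1 - monom 1 (c + 2)) * (1 - monom 1 (c + 3) :: int poly)"
    by (simp_all add: q_poch_def numeral_eq_Suc)
  have "fps_of_poly (q_binomial (c + 3) 3) * ((1 - fps_X ^ 1) * (1 - fps_X ^ 2) * (1 - fps_X ^ 3)) =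
      (1 - fps_X ^ (c + 1)) * (1 - fps_X ^ (c + 2)) * (1 - fps_X ^ (c + 3))"
    using arg_cong[OF q_binomial_mult_q_poch[of c 3], of fps_of_poly]
    unfolding q p fps_of_poly_mult fps_of_poly_one_minus_monom .
  then have "(1 - fps_X) * fps_of_poly (q_binomial (c + 3) 3) *
      ((1 - fps_X ^ 2) * (1 - fps_X ^ 3) * part23) =
      (1 - fps_X ^ (c + 1)) * ((1 - fps_X ^ (c + 2)) * ((1 - fps_X ^ (c + 3)) * part23))"
    by (simp only: mult_ac power_one_right)
  then show ?thesis by (simp only: part23_inverse mult_1_right)
qed

lemma fps_q_binomial_5:
  "(1 - fps_X) * fps_of_poly (q_binomial (n + 5) 5) =
   (1 - fps_X ^ (n + 1)) * ((1 - fps_X ^ (n + 2)) * ((1 - fps_X ^ (n + 3)) *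
     ((1 - fps_X ^ (n + 4)) * ((1 - fps_X ^ (n + 5)) * part2345))))"
proof -
  have q: "q_poch 5 = (1 - monom 1 1) * (1 - monom 1 2) * (1 - monom 1 3) *
      (1 - monom 1 4) * (1 - monom 1 5)"
    and p: "(\<Prod>i = 1..5. 1 - monom 1 (n + i)) =
      (1 - monom 1 (n + 1)) * (1 - monom 1 (n + 2)) * (1 - monom 1 (n + 3)) *
      (1 - monom 1 (n + 4)) * (1 - monom 1 (n + 5) :: int poly)"
    by (simp_all add: q_poch_def numeral_eq_Suc)
  have "fps_of_poly (q_binomial (n + 5) 5) * ((1 - fps_X ^ 1) * (1 - fps_X ^ 2) * (1 - fps_X ^ 3) *
      (1 - fps_X ^ 4) * (1 - fps_X ^ 5)) =
      (1 - fps_X ^ (n + 1)) * (1 - fps_X ^ (n + 2)) * (1 - fps_X ^ (n + 3)) *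
      (1 - fps_X ^ (n + 4)) * (1 - fps_X ^ (n + 5))"
    using arg_cong[OF q_binomial_mult_q_poch[of n 5], of fps_of_poly]
    unfolding q p fps_of_poly_mult fps_of_poly_one_minus_monom .
  then have "(1 - fps_X) * fps_of_poly (q_binomial (n + 5) 5) *
      ((1 - fps_X ^ 2) * (1 - fps_X ^ 3) * (1 - fps_X ^ 4) * (1 - fps_X ^ 5) * part2345) =
      (1 - fps_X ^ (n + 1)) * ((1 - fps_X ^ (n + 2)) * ((1 - fps_X ^ (n + 3)) *
        ((1 - fps_X ^ (n + 4)) * ((1 - fps_X ^ (n + 5)) * part2345))))"
    by (simp only: mult_ac power_one_right)
  then show ?thesis by (simp only: part2345_inverse mult_1_right)
qed

definition incr :: "int poly \<Rightarrow> int \<Rightarrow> int" where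
  "incr p x = zcoeff (fps_of_poly p) x - zcoeff (fps_of_poly p) (x - 1)"

lemma incr_eq_zcoeff: "incr p x = zcoeff ((1 - fps_X) * fps_of_poly p) x"
  using zcoeff_one_minus_X_power_mult[of 1 "fps_of_poly p" x] by (simp add: incr_def)

lemma incr_Suc: "incr p (int i + 1) = coeff p (Suc i) - coeff p i"
  using zcoeff_of_nat[of _ "Suc i"] by (simp add: incr_def zcoeff_of_nat add.commute)

text \<open>Up to the centre, two or more of the numerator shifts total at least
  \<open>2 * c + 3 > x\<close>, so only single shifts survive.\<close>

lemma incr_q_binomial_3:
  assumes "2 * x \<le> 3 * int c"
  shows "incr (q_binomial (c + 3) 3) x = zcoeff part23 x - zcoeff part23 (x - int c - 1)
    - zcoeff part23 (x - int c - 2) - zcoeff part23 (x - int c - 3)"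
  using assms
  unfolding incr_eq_zcoeff fps_q_binomial_3 zcoeff_one_minus_X_power_mult
  by (simp add: algebra_simps)

lemma incr_q_binomial_3_le:
  assumes "2 * x \<le> 3 * int c"
  shows "incr (q_binomial (c + 3) 3) x \<le> zcoeff part23 x"
  using incr_q_binomial_3[OF assms] part_fps_nonneg(1)[of "x - int c - 1"]
    part_fps_nonneg(1)[of "x - int c - 2"] part_fps_nonneg(1)[of "x - int c - 3"]
  by linarith

text \<open>Up to the centre, three or more shifts total at least \<open>3 * n + 6 > x\<close>. The
  coefficients of the \<open>z\<close> terms count the pairs of distinct numbers from 1 to 5 with
  sum 3 to 9.\<close>

lemma incr_q_binomial_5:
  assumes "2 * x \<le> 5 * int n"
  shows "incr (q_binomial (n + 5) 5) x =
    (let P = zcoeff part2345; y = x - int n; z = x - 2 * int n in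
      P x - (P (y - 1) + P (y - 2) + P (y - 3) + P (y - 4) + P (y - 5)) +
      (P (z - 3) + P (z - 4) + 2 * P (z - 5) + 2 * P (z - 6) + 2 * P (z - 7) + P (z - 8) + P (z - 9)))"
  using assms
  unfolding incr_eq_zcoeff fps_q_binomial_5 zcoeff_one_minus_X_power_mult
  by (simp add: Let_def algebra_simps)


section \<open>Lower bound for the increments of \<open>q_binomial (n + 5) 5\<close>\<close>

lemma cub_lower_left:
  assumes "n \<ge> 100" "1 \<le> y" "y \<le> n + 2"
  shows "n\<^sup>2 \<le> cub (n + y) - (cub (y - 1) + cub (y - 2) + cub (y - 3) + cub (y - 4) + cub (y - 5))"
proof -
  have eq: "cub (n + y) - (cub (y - 1) + cub (y - 2) + cub (y - 3) + cub (y - 4) + cub (y - 5)) =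
      n * n * n + 3 * (n * n * y) + 3 * (n * y * y) - 4 * (y * y * y) + 21 * (n * n) + 42 * (n * y)
      - 39 * (y * y) + 465 * y - 930"
    by (simp add: cub_def power2_eq_square power3_eq_cube algebra_simps)
  \<comment> \<open>The negative cubic term is traded through \<open>n * y * y\<close> for
    \<open>n * n * y\<close> using \<open>y \<le> n + 2\<close>; then \<open>n \<ge> 100\<close>
    controls the lower order terms.\<close>
  have 1: "y * y * y \<le> n * y * y + 2 * (y * y)"
    using mult_right_mono[OF assms(3), of "y * y"] by (simp add: algebra_simps)
  have 2: "n * y * y \<le> n * n * y + 2 * (n * y)"
    using mult_right_mono[OF assms(3), of "n * y"] assms by (simp add: algebra_simps)
  have 3: "y * y \<le> n * y + 2 * y"
    using mult_right_mono[OF assms(3), of y] assms by (simp add: algebra_simps)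
  have 4: "100 * (n * y) \<le> n * n * y"
    using mult_right_mono[OF assms(1), of "n * y"] assms by (simp add: algebra_simps)
  have 5: "100 * n \<le> n * n"
    using mult_right_mono[OF assms(1), of n] assms by (simp add: algebra_simps)
  have 6: "0 \<le> n * n * n" "0 \<le> n * y"
    using assms by simp_all
  show ?thesis
    unfolding eq power2_eq_square using 1 2 3 4 5 6 assms by linarith
qed

lemma cub_lower_middle:
  assumes "n \<ge> 0" "2 * n \<le> x" "2 * x \<le> 5 * n"
  defines "y \<equiv> x - n" and "z \<equiv> x - 2 * n"
  shows "n\<^sup>2 \<le> cub x - (cub (y - 1) + cub (y - 2) + cub (y - 3) + cub (y - 4) + cub (y - 5)) +
    (cub (z - 3) + cub (z - 4) + 2 * cub (z - 5) + 2 * cub (z - 6) + 2 * cub (z - 7) +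
      cub (z - 8) + cub (z - 9))" (is "_ \<le> ?S")
proof -
  \<comment> \<open>Twice the distance to the centre. In \<open>n\<close> and \<open>w\<close> no
    \<open>n ^ 3\<close> term remains, so at \<open>w = 0\<close> the leading term of
    \<open>8 * ?S\<close> is \<open>30 * (n * n)\<close>. The factor 8 clears the halves in
    \<open>y\<close> and \<open>z\<close>.\<close>
  define w where "w = 5 * n - 2 * x"
  have w: "0 \<le> w" "w \<le> n"
    using assms by (auto simp: w_def)
  have eq: "8 * ?S = 30 * (n * n * w) + 30 * (n * n) + 180 * (n * w) + 180 * n + 3540 * w + 36480
      - 6 * (w * w * w) - 18 * (w * w)"
    by (simp add: cub_def y_def z_def w_def power2_eq_square power3_eq_cube algebra_simps)
  have "w * w * w \<le> n * n * w" "w * w \<le> n * w" "0 \<le> n * n * w" "0 \<le> n * w" "0 \<le> n * n"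
    using w assms(1) by (auto intro!: mult_mono)
  then have "8 * n\<^sup>2 \<le> 8 * ?S"
    unfolding eq power2_eq_square using w assms(1) by linarith
  then show ?thesis by simp
qed

text \<open>The target \<open>300 * int n + 720\<close> is the bound of \<open>part23_le\<close>,
  scaled by 120, at the largest argument \<open>5 n / 2\<close>.\<close>

lemma incr_q_binomial_5_lower:
  obtains N :: nat where
    "\<And>n x. N \<le> n \<Longrightarrow> int n < x \<Longrightarrow> 2 * x \<le> 5 * int n \<Longrightarrow>
      300 * int n + 720 \<le> 720 * incr (q_binomial (n + 5) 5) x"
proof -
  obtain K where K: "K \<ge> 0"
    "\<And>x. x \<ge> -14 \<Longrightarrow> \<bar>720 * zcoeff part2345 x - cub x\<bar> \<le> K * (\<bar>x\<bar> + 1)"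
    using part2345_estimate by metis
  show thesis
  \<comment> \<open>Counted with multiplicity, at most 1 + 5 + 10 = 16 values of
    \<open>part2345\<close> enter, each with error at most \<open>3 * K * n\<close>; hence 48. The
    1000 leaves room for the target.\<close>
  proof (rule that[of "nat (48 * K + 1000)"])
    fix n :: nat and x :: int
    assume n: "nat (48 * K + 1000) \<le> n" and x: "int n < x" "2 * x \<le> 5 * int n"
    define W where "W = K * int n"
    have n': "48 * K + 1000 \<le> int n" using n by linarith
    have W: "0 \<le> W" using K(1) by (simp add: W_def)
    have n2: "48 * W + 1000 * int n \<le> (int n)\<^sup>2"
      using mult_right_mono[OF n', of "int n"] by (simp add: W_def power2_eq_square algebra_simps)
    have n1000: "int n \<ge> 1000" using n' K(1) by linarith
    define P where "P = zcoeff part2345"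
    have est: "cub t - 3 * W \<le> 720 * P t \<and> 720 * P t \<le> cub t + 3 * W"
      if "t \<ge> -14" "\<bar>t\<bar> + 1 \<le> 3 * int n" for t
    proof -
      have "K * (\<bar>t\<bar> + 1) \<le> 3 * W"
        using mult_left_mono[OF that(2) K(1)] by (simp add: W_def)
      then show ?thesis using K(2)[OF that(1)] unfolding P_def by linarith
    qed
    define y z where "y = x - int n" and "z = x - 2 * int n"
    have incr: "incr (q_binomial (n + 5) 5) x =
      P x - (P (y - 1) + P (y - 2) + P (y - 3) + P (y - 4) + P (y - 5)) +
      (P (z - 3) + P (z - 4) + 2 * P (z - 5) + 2 * P (z - 6) + 2 * P (z - 7) + P (z - 8) + P (z - 9))"
      using incr_q_binomial_5[OF x(2)] by (simp add: P_def y_def z_def Let_def)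
    have ex: "cub x - 3 * W \<le> 720 * P x"
      using est[of x] x n1000 by linarith
    have ey: "720 * P (y - k) \<le> cub (y - k) + 3 * W" if "1 \<le> k" "k \<le> 5" for k
      using est[of "y - k"] that x n1000 unfolding y_def by linarith
    have ey': "720 * P (y - 1) \<le> cub (y - 1) + 3 * W" "720 * P (y - 2) \<le> cub (y - 2) + 3 * W"
      "720 * P (y - 3) \<le> cub (y - 3) + 3 * W" "720 * P (y - 4) \<le> cub (y - 4) + 3 * W"
      "720 * P (y - 5) \<le> cub (y - 5) + 3 * W"
      by (rule ey; simp)+
    show "300 * int n + 720 \<le> 720 * incr (q_binomial (n + 5) 5) x"
    \<comment> \<open>Below this threshold even the smallest pair shift exceeds \<open>x\<close>.
      Beyond it the arguments \<open>z - k\<close> are at least -6, within the range of the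
      estimate.\<close>
    proof (cases "x < 2 * int n + 3")
      case True
      have zero: "P (z - 3) = 0" "P (z - 4) = 0" "P (z - 5) = 0" "P (z - 6) = 0" "P (z - 7) = 0"
        "P (z - 8) = 0" "P (z - 9) = 0"
        using True by (simp_all add: P_def z_def)
      have "(int n)\<^sup>2 \<le>
          cub x - (cub (y - 1) + cub (y - 2) + cub (y - 3) + cub (y - 4) + cub (y - 5))"
        using cub_lower_left[of "int n" y] True x n1000 by (simp add: y_def)
      then show ?thesis
        unfolding incr zero distrib_left right_diff_distrib using ex ey' n2 n1000 W by linarith
    next
      case False
      have ez: "cub (z - k) - 3 * W \<le> 720 * P (z - k)" if "3 \<le> k" "k \<le> 9" for k
        using est[of "z - k"] that False x n1000 unfolding z_def by linarith
      have ez': "cub (z - 3) - 3 * W \<le> 720 * P (z - 3)" "cub (z - 4) - 3 * W \<le> 720 * P (z - 4)"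
        "cub (z - 5) - 3 * W \<le> 720 * P (z - 5)" "cub (z - 6) - 3 * W \<le> 720 * P (z - 6)"
        "cub (z - 7) - 3 * W \<le> 720 * P (z - 7)" "cub (z - 8) - 3 * W \<le> 720 * P (z - 8)"
        "cub (z - 9) - 3 * W \<le> 720 * P (z - 9)"
        by (rule ez; simp)+
      have "(int n)\<^sup>2 \<le> cub x -
          (cub (y - 1) + cub (y - 2) + cub (y - 3) + cub (y - 4) + cub (y - 5)) +
          (cub (z - 3) + cub (z - 4) + 2 * cub (z - 5) + 2 * cub (z - 6) + 2 * cub (z - 7) +
            cub (z - 8) + cub (z - 9))"
        unfolding y_def z_def using False x by (intro cub_lower_middle) auto
      then show ?thesis
        unfolding incr distrib_left right_diff_distrib using ex ey' ez' n2 n1000 W by linarith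
    qed
  qed
qed

section \<open>The polynomial \<open>f5\<close>\<close>

text \<open>\<open>N\<close> may exceed the degree: for \<open>j = 0\<close> the constant terms of
  \<open>f5\<close> cancel. Symmetry about \<open>N / 2\<close> turns the rise of the first half
  into a fall of the second.\<close>

lemma symmetric_unimodal:
  fixes p :: "int poly"
  assumes deg: "degree p \<le> N"
    and sym: "\<And>i. i \<le> N \<Longrightarrow> coeff p (N - i) = coeff p i"
    and inc: "\<And>i. 2 * Suc i \<le> N \<Longrightarrow> coeff p i \<le> coeff p (Suc i)"
    and nonneg0: "coeff p 0 \<ge> 0"
  shows "nonneg_poly p \<and> unimodal_poly p"
proof -
  define K where "K = N div 2"
  have up: "coeff p i \<le> coeff p j" if "i \<le> j" "j \<le> K" for i j
    using that
  proof (induction rule: dec_induct)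
    case (step j)
    then have "coeff p j \<le> coeff p (Suc j)"
      by (intro inc) (auto simp: K_def)
    with step show ?case by simp
  qed simp
  have down: "coeff p j \<le> coeff p i" if "K \<le> i" "i \<le> j" "j \<le> N" for i j
  proof (cases "i = j")
    case False
    then have "coeff p (N - j) \<le> coeff p (min K (N - i))"
      using that by (intro up) (auto simp: K_def)
    \<comment> \<open>For odd \<open>N\<close> and \<open>i = K\<close> the mirror index
      \<open>N - i\<close> is \<open>K + 1\<close>; the minimum brings it back to
      \<open>K\<close>.\<close>
    moreover have "coeff p (min K (N - i)) = coeff p i"
    proof (cases "i = K")
      case True
      then show ?thesis by (simp add: K_def)
    next
      case False
      then have "min K (N - i) = N - i" using that by (auto simp: K_def)
      then show ?thesis using sym that by simp
    qed
    ultimately show ?thesis using sym that by simp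
  qed simp
  have "coeff p i \<ge> 0" for i
  proof -
    consider "i \<le> K" | "K < i" "i \<le> N" | "i > N" by linarith
    then show ?thesis
    proof cases
      case 1
      then show ?thesis using up[of 0 i] nonneg0 by simp
    next
      case 2
      then have "coeff p (N - i) \<ge> coeff p 0"
        by (intro up) (auto simp: K_def)
      then show ?thesis using sym 2 nonneg0 by simp
    next
      case 3
      then show ?thesis using deg by (simp add: coeff_eq_0)
    qed
  qed
  moreover have "mono_on {0..min K (degree p)} (coeff p)"
    by (intro monotone_onI) (auto intro: up)
  moreover have "antimono_on {min K (degree p)..degree p} (coeff p)"
  proof (cases "K \<le> degree p")
    case True
    then show ?thesis using deg by (intro monotone_onI) (auto intro: down)
  qed (auto simp: monotone_on_def)
  ultimately show ?thesis
    unfolding nonneg_poly_def unimodal_poly_def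
    by (metis min.cobounded2)
qed

lemma not_unimodal_dip:
  assumes "nonneg_poly p" "coeff p 1 < coeff p 0" "coeff p 1 < coeff p 2"
  shows "\<not> unimodal_poly p"
proof
  assume "unimodal_poly p"
  then obtain k where k: "mono_on {0..k} (coeff p)" "antimono_on {k..degree p} (coeff p)"
    by (auto simp: unimodal_poly_def)
  \<comment> \<open>Nonnegativity makes \<open>coeff p 2\<close> positive, which places index 2
    inside the range of the fall.\<close>
  have "coeff p 1 \<ge> 0"
    using assms(1) by (simp add: nonneg_poly_def)
  then have "2 \<le> degree p"
    using assms(3) by (intro le_degree) auto
  show False
  proof (cases "k = 0")
    case True
    then have "coeff p 2 \<le> coeff p 1"
      using monotone_onD[OF k(2), of 1 2] \<open>2 \<le> degree p\<close> by simp
    then show False using assms(3) by simp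
  next
    case False
    then have "coeff p 0 \<le> coeff p 1"
      using monotone_onD[OF k(1), of 0 1] by simp
    then show False using assms(2) by simp
  qed
qed

text \<open>The exponent of \<open>f5\<close> rewritten for \<open>m = n + 5\<close> and
  \<open>b = c + 3\<close>: the constants cancel, and the centres \<open>5 n / 2\<close> and
  \<open>j + 3 c / 2\<close> agree.\<close>

context
  fixes n c j :: nat
  assumes balance: "5 * n = 3 * c + 2 * j"
begin

lemma balance_int: "5 * int n = 3 * int c + 2 * int j"
  using arg_cong[OF balance, of int] by simp

lemma f5_eq: "f5 (n + 5) (c + 3) = q_binomial (n + 5) 5 - monom 1 j * q_binomial (c + 3) 3"
proof -
  have "(5 * (n + 5) - 3 * (c + 3) - 16) div 2 = j"
    using balance by simp
  then show ?thesis by (simp add: f5_def)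
qed

lemma incr_f5:
  "incr (f5 (n + 5) (c + 3)) x =
    incr (q_binomial (n + 5) 5) x - incr (q_binomial (c + 3) 3) (x - int j)"
  by (simp add: incr_def f5_eq fps_of_poly_diff fps_of_poly_mult fps_of_poly_monom' zcoeff_diff
      zcoeff_X_power_mult algebra_simps)

text \<open>By \<open>balance\<close> the reflection of \<open>i\<close> to \<open>5 * n - i\<close>
  preserves the interval from \<open>j\<close> to \<open>j + 3 * c\<close>, outside which both
  coefficients vanish.\<close>

lemma coeff_monom_mult_q_binomial_sym:
  assumes "i \<le> 5 * n"
  shows "coeff (monom 1 j * q_binomial (c + 3) 3) (5 * n - i) =
    coeff (monom 1 j * q_binomial (c + 3) 3) i"
proof -
  consider "i < j" | "j \<le> i" "i \<le> j + 3 * c" | "j + 3 * c < i" by linarith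
  then show ?thesis
  proof cases
    case 2
    then have "5 * n - i - j = 3 * c - (i - j)" "j \<le> 5 * n - i"
      using balance by auto
    then show ?thesis
      using 2 coeff_q_binomial_sym[of "i - j" 3 c] by (simp add: coeff_monom_mult)
  qed (use balance assms in \<open>auto simp: coeff_monom_mult coeff_eq_0 degree_q_binomial\<close>)
qed

lemma f5_sym:
  "i \<le> 5 * n \<Longrightarrow> coeff (f5 (n + 5) (c + 3)) (5 * n - i) = coeff (f5 (n + 5) (c + 3)) i"
  using coeff_monom_mult_q_binomial_sym coeff_q_binomial_sym[of i 5 n] by (simp add: f5_eq)

lemma degree_f5_le: "degree (f5 (n + 5) (c + 3)) \<le> 5 * n"
  unfolding f5_eq
proof (rule degree_diff_le)
  show "degree (monom 1 j * q_binomial (c + 3) 3) \<le> 5 * n"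
    using degree_mult_le[of "monom 1 j" "q_binomial (c + 3) 3"] degree_monom_le[of "1::int" j] balance
    by (simp add: degree_q_binomial)
qed (simp add: degree_q_binomial)

lemma incr_f5_left:
  assumes "j \<noteq> 1" "x \<le> int n"
  shows "incr (f5 (n + 5) (c + 3)) x \<ge> 0"
proof -
  have "incr (q_binomial (c + 3) 3) (x - int j) \<le> zcoeff part23 (x - int j)"
    using balance_int assms by (intro incr_q_binomial_3_le) (simp add: algebra_simps)
  also have "\<dots> \<le> zcoeff part23 x"
    using assms(1) by (rule part23_shift_le)
  also have "\<dots> \<le> zcoeff part2345 x"
    by (rule part23_le_part2345)
  \<comment> \<open>For \<open>x \<le> n\<close> all shifted terms of the increment formula have
    negative arguments.\<close>
  also have "\<dots> = incr (q_binomial (n + 5) 5) x"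
    using assms(2) by (subst incr_q_binomial_5) (auto simp: Let_def)
  finally show ?thesis by (simp add: incr_f5)
qed

lemma incr_f5_right:
  assumes "300 * int n + 720 \<le> 720 * incr (q_binomial (n + 5) 5) x" "2 * x \<le> 5 * int n"
  shows "incr (f5 (n + 5) (c + 3)) x \<ge> 0"
proof -
  have "incr (q_binomial (c + 3) 3) (x - int j) \<le> zcoeff part23 (x - int j)"
    using balance_int assms by (intro incr_q_binomial_3_le) (simp add: algebra_simps)
  moreover have "720 * zcoeff part23 (x - int j) \<le> 300 * int n + 720"
  proof (cases "x < int j")
    case False
    then show ?thesis using part23_le[of "x - int j"] assms(2) by linarith
  qed simp
  ultimately show ?thesis
    using assms(1) by (simp add: incr_f5)
qed

lemma f5_nonneg_unimodal:
  assumes "j \<noteq> 1"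
    and "\<And>x. int n < x \<Longrightarrow> 2 * x \<le> 5 * int n \<Longrightarrow>
      300 * int n + 720 \<le> 720 * incr (q_binomial (n + 5) 5) x"
  shows "nonneg_poly (f5 (n + 5) (c + 3)) \<and> unimodal_poly (f5 (n + 5) (c + 3))"
proof (rule symmetric_unimodal[where N = "5 * n"])
  have incr: "incr (f5 (n + 5) (c + 3)) x \<ge> 0" if "2 * x \<le> 5 * int n" for x
    using incr_f5_left[of x] incr_f5_right[of x] assms that by force
  show "coeff (f5 (n + 5) (c + 3)) i \<le> coeff (f5 (n + 5) (c + 3)) (Suc i)"
    if "2 * Suc i \<le> 5 * n" for i
    using incr[of "int i + 1"] that by (simp add: incr_Suc)
  show "coeff (f5 (n + 5) (c + 3)) 0 \<ge> 0"
    using incr[of 0] by (simp add: incr_def zcoeff_def)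
qed (use f5_sym degree_f5_le in auto)

lemma f5_not_nonneg_unimodal:
  assumes "j = 1" "n \<ge> 2"
  shows "\<not> (nonneg_poly (f5 (n + 5) (c + 3)) \<and> unimodal_poly (f5 (n + 5) (c + 3)))"
proof -
  have P: "zcoeff part2345 1 = 0" "zcoeff part2345 2 = 1"
    using part2345_rec[of 1] part234_rec[of 1] part2345_rec[of 2] part234_rec[of 2]
    by (simp_all add: part23_small)
  have C5: "incr (q_binomial (n + 5) 5) x = zcoeff part2345 x" if "x \<le> 2" for x
    using assms(2) that by (subst incr_q_binomial_5) (auto simp: Let_def)
  have "incr (q_binomial (c + 3) 3) 0 = 1"
    by (simp add: incr_q_binomial_3 part_fps_at_0)
  moreover have "incr (q_binomial (c + 3) 3) 1 \<le> 0"
    using incr_q_binomial_3_le[of 1 c] balance assms by (simp add: part23_small)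
  \<comment> \<open>The increment at 1 is \<open>0 - 1\<close>, the one at 2 is at least
    \<open>1 - 0\<close>.\<close>
  ultimately have "incr (f5 (n + 5) (c + 3)) 1 < 0" "incr (f5 (n + 5) (c + 3)) 2 > 0"
    using P C5[of 1] C5[of 2] assms(1) by (simp_all add: incr_f5)
  then have "coeff (f5 (n + 5) (c + 3)) 1 < coeff (f5 (n + 5) (c + 3)) 0"
    "coeff (f5 (n + 5) (c + 3)) 1 < coeff (f5 (n + 5) (c + 3)) 2"
    using incr_Suc[of "f5 (n + 5) (c + 3)" 0] incr_Suc[of "f5 (n + 5) (c + 3)" 1]
    by (simp_all add: numeral_2_eq_2)
  then show ?thesis
    using not_unimodal_dip by blast
qed

end

section \<open>Return from \<open>n\<close>, \<open>c\<close>, \<open>j\<close> to \<open>m\<close>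
  and \<open>b\<close>\<close>

theorem theorem2p4:
  shows "\<exists>M. \<forall>m \<ge> M. m \<ge> 5 \<longrightarrow>
    (\<forall>b. 3 \<le> b \<and> real b \<le> (5 * real m - 16) / 3 \<and> [b = m] (mod 2) \<longrightarrow>
       (real b \<noteq> (5 * real m - 18) / 3 \<longrightarrow> nonneg_poly (f5 m b) \<and> unimodal_poly (f5 m b)) \<and>
       (real b = (5 * real m - 18) / 3 \<longrightarrow> \<not> (nonneg_poly (f5 m b) \<and> unimodal_poly (f5 m b)))) \<and>
    ((5 * real m - 18) / 3 \<in> \<int> \<longleftrightarrow> (3::int) dvd 2 * int m - 6)"
proof -
  obtain N :: nat where N:
    "\<And>n x. N \<le> n \<Longrightarrow> int n < x \<Longrightarrow> 2 * x \<le> 5 * int n \<Longrightarrow>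
      300 * int n + 720 \<le> 720 * incr (q_binomial (n + 5) 5) x"
    using incr_q_binomial_5_lower by blast
  show ?thesis
  \<comment> \<open>This gives \<open>n = m - 5 \<ge> N + 2\<close>, enough for the increment bound
    and for \<open>n \<ge> 2\<close> in the exceptional case.\<close>
  proof (intro exI[of _ "N + 7"] allI impI conjI)
    fix m b :: nat
    assume m: "N + 7 \<le> m" and b: "3 \<le> b \<and> real b \<le> (5 * real m - 16) / 3 \<and> [b = m] (mod 2)"
    define n c j where "n = m - 5" and "c = b - 3" and "j = (5 * m - 3 * b - 16) div 2"
    have mb: "m = n + 5" "b = c + 3"
      using m b by (auto simp: n_def c_def)
    have "real (3 * b + 16) \<le> real (5 * m)"
      using b by (simp add: field_simps)
    then have le: "3 * b + 16 \<le> 5 * m"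
      by (simp only: of_nat_le_iff)
    have "b mod 2 = m mod 2"
      using b by (simp add: cong_def)
    then have "even b \<longleftrightarrow> even m"
      by (simp add: even_iff_mod_2_eq_zero)
    with le have "even (5 * m - 3 * b - 16)"
      by simp
    with le have j: "5 * m = 3 * b + 16 + 2 * j"
      by (auto simp: j_def)
    then have balance: "5 * n = 3 * c + 2 * j"
      using mb by simp
    have j1: "real b = (5 * real m - 18) / 3 \<longleftrightarrow> j = 1"
      using arg_cong[OF j, of real] by (auto simp: field_simps)
    show "nonneg_poly (f5 m b)" "unimodal_poly (f5 m b)" if "real b \<noteq> (5 * real m - 18) / 3"
      using f5_nonneg_unimodal[OF balance] N[of n] that j1 m mb by auto
    show "\<not> (nonneg_poly (f5 m b) \<and> unimodal_poly (f5 m b))" if "real b = (5 * real m - 18) / 3"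
      using f5_not_nonneg_unimodal[OF balance] that j1 m mb by auto
  next
    fix m :: nat
    \<comment> \<open>The numbers \<open>5 m - 18\<close> and \<open>2 m - 6\<close> differ by
      \<open>3 m - 12\<close>, a multiple of 3.\<close>
    show "(5 * real m - 18) / 3 \<in> \<int> \<longleftrightarrow> (3::int) dvd 2 * int m - 6"
    proof
      assume "(5 * real m - 18) / 3 \<in> \<int>"
      then obtain k :: int where "(5 * real m - 18) / 3 = of_int k"
        by (elim Ints_cases)
      then have "real_of_int (5 * int m - 18) = real_of_int (3 * k)"
        by (simp add: field_simps)
      then have "5 * int m - 18 = 3 * k"
        by (simp only: of_int_eq_iff)
      then show "(3::int) dvd 2 * int m - 6" by presburger
    next
      assume "(3::int) dvd 2 * int m - 6"
      then have "(3::int) dvd 5 * int m - 18" by presburger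
      then obtain k where "5 * int m - 18 = 3 * k" by (elim dvdE)
      then have "real_of_int (5 * int m - 18) = real_of_int (3 * k)"
        by simp
      then have "(5 * real m - 18) / 3 = of_int k"
        by (simp add: field_simps)
      then show "(5 * real m - 18) / 3 \<in> \<int>" by simp
    qed
  qed
qed

end
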